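(* Let $M_3$ be the algebra of $3\times 3$ complex matrices, let $\mathcal P(M_3)$ be the convex cone of all positive linear maps $M_3\to M_3$, and let $\Phi:M_3\to M_3$ be the Choi map $$\Phi(X)=\begin{pmatrix} x_{11}+x_{33} & -x_{12} & -x_{13}\\ -x_{21} & x_{22}+x_{11} & -x_{23}\\ -x_{31} & -x_{32} & x_{33}+x_{22}\end{pmatrix},\qquad X=(x_{ij})\in M_3.$$ Then $\Phi$ generates an extreme ray of the cone $\mathcal P(M_3)$.
   Context: A complex-linear map $\phi:M_3\to M_3$ is called positive if it maps positive semi-definite (Hermitian) matrices to positive semi-definite matrices. A nonzero element $\Phi$ of a convex cone $C$ generates an extreme ray of $C$ (is extremal in $C$) if whenever $\Phi=\phi_1+\phi_2$ with $\phi_1,\phi_2\in C$, each of $\phi_1,\phi_2$ is a nonnegative scalar multiple of $\Phi$. *)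

theory Defs
  imports "HOL-Analysis.Analysis"
begin

(* On complex^'n^'m the operation *\<^sub>R takes only real scalars and *s takes row vectors as
   scalars, so multiplication by a complex number is spelled out. *)
definition cscale_mat :: "complex \<Rightarrow> complex^'n^'m \<Rightarrow> complex^'n^'m" where
  "cscale_mat c A = (\<chi> i j. c * A $ i $ j)"

lemma vector_space_cscale_mat: "vector_space (cscale_mat :: complex \<Rightarrow> complex^'n^'m \<Rightarrow> _)"
  by unfold_locales (simp_all add: cscale_mat_def vec_eq_iff algebra_simps)

definition hermitian :: "complex^'n^'n \<Rightarrow> bool" where
  "hermitian A \<longleftrightarrow> (\<forall>i j. A $ i $ j = cnj (A $ j $ i))"

definition pos_semidef :: "complex^'n^'n \<Rightarrow> bool" where
  "pos_semidef A \<longleftrightarrow> hermitian A \<and> (\<forall>v. (\<Sum>i\<in>UNIV. cnj (v $ i) * (A *v v) $ i) \<in> \<real>\<^sub>\<ge>\<^sub>0)"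

definition positive_maps :: "(complex^'n^'n \<Rightarrow> complex^'m^'m) set" where
  "positive_maps = {\<phi>. Vector_Spaces.linear cscale_mat cscale_mat \<phi> \<and>
                       (\<forall>X. pos_semidef X \<longrightarrow> pos_semidef (\<phi> X))}"

(* For cones of functions, with pointwise addition and pointwise real scaling. *)
definition generates_extreme_ray ::
    "('a \<Rightarrow> 'b::real_vector) set \<Rightarrow> ('a \<Rightarrow> 'b) \<Rightarrow> bool" where
  "generates_extreme_ray C \<Phi> \<longleftrightarrow>
     \<Phi> \<in> C \<and> \<Phi> \<noteq> (\<lambda>X. 0) \<and>
     (\<forall>\<phi>1\<in>C. \<forall>\<phi>2\<in>C. \<Phi> = (\<lambda>X. \<phi>1 X + \<phi>2 X) \<longrightarrow>
        (\<exists>c\<ge>0. \<phi>1 = (\<lambda>X. c *\<^sub>R \<Phi> X)) \<and> (\<exists>c\<ge>0. \<phi>2 = (\<lambda>X. c *\<^sub>R \<Phi> X)))"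

definition choi_map :: "complex^3^3 \<Rightarrow> complex^3^3" where
  "choi_map X = vector
     [vector [X$1$1 + X$3$3, - X$1$2,         - X$1$3],
      vector [- X$2$1,         X$2$2 + X$1$1, - X$2$3],
      vector [- X$3$1,         - X$3$2,         X$3$3 + X$2$2]]"

lemma choi_map_entries:
  "choi_map X $ 1 $ 1 = X$1$1 + X$3$3" "choi_map X $ 2 $ 2 = X$2$2 + X$1$1"
  "choi_map X $ 3 $ 3 = X$3$3 + X$2$2" "i \<noteq> j \<Longrightarrow> choi_map X $ i $ j = - X $ i $ j"
  using exhaust_3[of i] exhaust_3[of j] by (auto simp: choi_map_def)

end

theory Submission
  imports Defs
begin

text \<open>
  A positive map \<open>\<phi>\<close> is encoded by the biquadratic form \<open>B(x, w) = w\<^sup>* \<phi>(x x\<^sup>*) w \<ge> 0\<close>, or by the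
  coefficients \<open>c i j k l\<close>, the entry \<open>(k, l)\<close> of the image of the matrix unit \<open>E\<^sub>i\<^sub>j\<close>. Positivity of
  the Choi map \<open>\<Phi>\<close> reduces to nonnegativity of a real ternary biquadratic form
  (\<open>real_choi_form_nonneg\<close>), which is a form of AM-GM.

  Let \<open>\<Phi> = \<phi> + \<psi>\<close> with positive summands. Then the form of \<open>\<phi>\<close> lies between 0 and that of \<open>\<Phi>\<close>.
  Where the latter vanishes, so does the former, and since it is semidefinite in each of its two
  arguments, each argument is in the kernel of the corresponding matrix (\<open>output_null\<close>,
  \<open>input_null\<close>). Two families of zeros are used. At the points \<open>(x, x)\<close> with all \<open>|x i| = 1\<close> the kernel
  conditions say that certain Laurent polynomials vanish on the torus, so that their coefficients are
  zero (\<open>torus_cubic\<close>). At the points \<open>(e\<^sub>i, e\<^sub>i\<^sub>-\<^sub>1)\<close>, with indices modulo 3, single entries of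
  the diagonal images vanish (\<open>coeff_vertex\<close>). Together they force the shape
  \<open>\<phi>(E\<^sub>i\<^sub>j) = \<lambda>\<^sub>i\<^sub>j E\<^sub>i\<^sub>j\<close> for distinct \<open>i, j\<close>, and \<open>\<phi>(E\<^sub>i\<^sub>i)\<close> is diagonal, supported on the
  positions \<open>i\<close> and \<open>i + 1\<close> (\<open>coeff_diag_offdiag\<close>, \<open>coeff_offdiag\<close>).

  The zeros alone leave several parameters. The missing relations come from the order of vanishing:
  along the curve \<open>x = e\<^sub>i + t e\<^sub>i\<^sub>-\<^sub>1\<close>, \<open>w = t e\<^sub>i + e\<^sub>i\<^sub>-\<^sub>1\<close> the form of \<open>\<Phi>\<close> equals
  \<open>t ^ 4\<close>, so the second order part of the form of \<open>\<phi>\<close> vanishes in this direction. As that part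
  is again semidefinite, this gives \<open>\<lambda> = - c i i i i = - c (i - 1) (i - 1) (i - 1) (i - 1)\<close> (\<open>coeff_edge\<close>). Going round
  the cycle, all coefficients are those of \<open>\<Phi>\<close> times one nonnegative factor (\<open>proportional\<close>).
\<close>

section \<open>The real Choi form\<close>

text \<open>
  This is AM-GM for the three summands, but in a cyclically symmetric form for which an explicit
  certificate exists: if \<open>b\<close> is the largest of the three, the difference of the two sides is a
  square times \<open>b\<close> plus a product of nonnegative factors. Any other case is a rotation of this one.
\<close>

lemma cyclic_sum_ge_3_prod:
  fixes a b c :: real
  assumes "0 \<le> a" "0 \<le> b" "0 \<le> c"
  shows "3 * a * b * c \<le> a\<^sup>2 * b + b\<^sup>2 * c + c\<^sup>2 * a"
proof -
  have *: "0 \<le> a\<^sup>2 * b + b\<^sup>2 * c + c\<^sup>2 * a - 3 * (a * b * c)"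
    if "0 \<le> a" "0 \<le> b" "0 \<le> c" "a \<le> b" "c \<le> b" for a b c :: real
  proof -
    have "a\<^sup>2 * b + b\<^sup>2 * c + c\<^sup>2 * a - 3 * (a * b * c) = b * (a - c)\<^sup>2 + c * ((b - c) * (b - a))"
      by (simp add: power2_eq_square algebra_simps)
    also have "\<dots> \<ge> 0"
      using that by simp
    finally show ?thesis .
  qed
  have abc: "b * c * a = a * b * c" "c * a * b = a * b * c" by simp_all
  consider "a \<le> b \<and> c \<le> b" | "b \<le> c \<and> a \<le> c" | "c \<le> a \<and> b \<le> a" by linarith
  then have "0 \<le> a\<^sup>2 * b + b\<^sup>2 * c + c\<^sup>2 * a - 3 * (a * b * c)"
  proof cases
    case 1 then show ?thesis using *[of a b c] assms by simp
  next
    case 2 then show ?thesis using *[of b c a] assms unfolding abc by linarith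
  next
    case 3 then show ?thesis using *[of c a b] assms unfolding abc by linarith
  qed
  then show ?thesis by (simp add: mult.assoc)
qed

text \<open>
  Square completion in \<open>t1\<close> and then in \<open>t2\<close>. The two pivots are \<open>D\<close> and the leading two-by-two
  minor \<open>M\<close>; what remains is governed by the determinant \<open>N\<close> of the form in the variables \<open>t\<close>, which
  is exactly the cyclic difference bounded by AM-GM at the squares of the \<open>s\<close>. A vanishing pivot
  forces so many of the \<open>s\<close> to vanish that no mixed term survives.
\<close>

lemma real_choi_form_nonneg:
  fixes s1 s2 s3 t1 t2 t3 :: real
  shows "0 \<le> (s1\<^sup>2 + s3\<^sup>2) * t1\<^sup>2 + (s2\<^sup>2 + s1\<^sup>2) * t2\<^sup>2 + (s3\<^sup>2 + s2\<^sup>2) * t3\<^sup>2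
    - 2 * (s1 * s2 * t1 * t2 + s1 * s3 * t1 * t3 + s2 * s3 * t2 * t3)" (is "0 \<le> ?F")
proof -
  define D where "D = s1\<^sup>2 + s3\<^sup>2"
  define M where "M = s1^4 + s2\<^sup>2 * s3\<^sup>2 + s1\<^sup>2 * s3\<^sup>2"
  define K where "K = s2 * s3 * (D + s1\<^sup>2)"
  define R where "R = D * (s3\<^sup>2 + s2\<^sup>2) - s1\<^sup>2 * s3\<^sup>2"
  define N where "N = (s1\<^sup>2)\<^sup>2 * s2\<^sup>2 + (s2\<^sup>2)\<^sup>2 * s3\<^sup>2 + (s3\<^sup>2)\<^sup>2 * s1\<^sup>2 - 3 * s1\<^sup>2 * s2\<^sup>2 * s3\<^sup>2"
  have "D * ?F = (D * t1 - s1 * s2 * t2 - s1 * s3 * t3)\<^sup>2 + (M * t2\<^sup>2 - 2 * K * t2 * t3 + R * t3\<^sup>2)"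
    unfolding K_def R_def M_def D_def by (simp add: power2_eq_square power4_eq_xxxx algebra_simps)
  moreover have "M * R - K\<^sup>2 = D * N"
    unfolding K_def R_def M_def D_def N_def by (simp add: power2_eq_square power4_eq_xxxx algebra_simps)
  moreover have "M * (M * t2\<^sup>2 - 2 * K * t2 * t3 + R * t3\<^sup>2) = (M * t2 - K * t3)\<^sup>2 + (M * R - K\<^sup>2) * t3\<^sup>2"
    by (simp add: power2_eq_square algebra_simps)
  ultimately have eq: "M * (D * ?F) = M * (D * t1 - s1 * s2 * t2 - s1 * s3 * t3)\<^sup>2 + ((M * t2 - K * t3)\<^sup>2 + D * N * t3\<^sup>2)"
    by (simp only: distrib_left)
  have N: "0 \<le> N"
    unfolding N_def using cyclic_sum_ge_3_prod[of "s1\<^sup>2" "s2\<^sup>2" "s3\<^sup>2"] by simp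
  have D: "0 \<le> D" and M: "0 \<le> M" by (simp_all add: D_def M_def)
  show ?thesis
  proof (cases "D = 0 \<or> M = 0")
    case True
    then have "s1 = 0 \<and> s2 * s3 = 0"
      by (auto simp: D_def M_def add_nonneg_eq_0_iff)
    then show ?thesis by auto
  next
    case False
    have "0 \<le> M * (D * ?F)"
      unfolding eq using D M N by simp
    moreover have "0 < M" "0 < D" using False D M by auto
    ultimately show ?thesis by (simp only: zero_le_mult_iff) linarith
  qed
qed

section \<open>Laurent polynomials on the torus\<close>

text \<open>
  Characters of the circle are linearly independent; three of the fourth roots of unity suffice here.
\<close>

lemma torus_linear:
  assumes "\<And>v::complex. cmod v = 1 \<Longrightarrow> A + B * v + C * cnj v = 0"
  shows "A = 0" "B = 0" "C = 0"
proof -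
  have "A + B + C = 0" "A - B - C = 0" "A + B * \<i> - C * \<i> = 0"
    using assms[of 1] assms[of "-1"] assms[of \<i>] by simp_all
  moreover from this have "2*A = 0" by algebra
  ultimately have "A = 0" "C = - B" "B * \<i> = C * \<i>" by (auto simp: add_eq_0_iff)
  then show "A = 0" "B = 0" "C = 0" by auto
qed

text \<open>
  A Laurent polynomial that vanishes on the torus is zero, so the coefficient of each monomial
  \<open>x i * x l / x j\<close> vanishes. The three conclusions are the coefficients of \<open>x p ^ 2 / x q\<close>, of
  \<open>x p * x q / x r\<close> and of \<open>x p\<close>. The last one collects five terms because \<open>x l * cnj (x l) = 1\<close>.
  By homogeneity it is enough to vary two of the variables, \<open>u = x p\<close> and \<open>v = x q\<close>.
\<close>

lemma torus_cubic:
  fixes g :: "3 \<Rightarrow> 3 \<Rightarrow> 3 \<Rightarrow> complex"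
  assumes zero: "\<And>x. (\<And>i. cmod (x i) = 1) \<Longrightarrow>
      (\<Sum>i\<in>UNIV. \<Sum>l\<in>UNIV. \<Sum>j\<in>UNIV. x i * x l * cnj (x j) * g i l j) = 0"
    and pqr: "p \<noteq> q" "p \<noteq> r" "q \<noteq> r"
  shows "g p p q = 0"
    and "g p q r + g q p r = 0"
    and "g p p p + g p q q + g q p q + g p r r + g r p r = 0"
proof -
  have U: "UNIV = {p,q,r}" using pqr exhaust_3[of p] exhaust_3[of q] exhaust_3[of r] by (auto simp: UNIV_3)
  define x where "x u v i = (if i = p then u else if i = q then v else 1)" for u v :: complex and i
  define f where "f u v = (\<Sum>i\<in>UNIV. \<Sum>l\<in>UNIV. \<Sum>j\<in>UNIV. x u v i * x u v l * cnj (x u v j) * g i l j)" for u v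
  have x: "x u v p = u" "x u v q = v" "x u v r = 1" for u v using pqr by (auto simp: x_def)
  have S: "(\<Sum>i\<in>UNIV. h i) = h p + h q + h r" for h :: "3 \<Rightarrow> complex" unfolding U using pqr by (simp add: add.assoc)
  have f0: "f u v = 0" if "cmod u = 1" "cmod v = 1" for u v
    unfolding f_def using that by (intro zero) (auto simp: x_def)
  { fix v assume v: "cmod v = 1"
    then have vv: "v * cnj v = 1" by (simp add: complex_norm_square[symmetric])
    have z: "f 1 v = 0" "f (-1) v = 0" "f \<i> v = 0" "f (-\<i>) v = 0" using f0 v by auto
    \<comment> \<open>Averaging over the fourth roots of unity in u isolates the power of u one wants: 2 here, 1 below.\<close>
    have e4: "4 * (g p p r + 0 * v + g p p q * cnj v) = f 1 v + f (-1) v - f \<i> v - f (-\<i>) v"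
      unfolding f_def S x by (simp add: algebra_simps)
    from this[unfolded z] have "g p p r + 0 * v + g p p q * cnj v = 0" by (simp only: add_0_left diff_self mult_eq_0_iff) simp
    moreover have "4 * ((g p p p + (v * cnj v) * (g p q q + g q p q) + g p r r + g r p r) + (g p q r + g q p r) * v
        + (g p r q + g r p q) * cnj v) = f 1 v - f (-1) v - \<i> * f \<i> v + \<i> * f (-\<i>) v"
      unfolding f_def S x by (simp add: algebra_simps)
    from this[unfolded z vv] have "(g p p p + (g p q q + g q p q) + g p r r + g r p r) + (g p q r + g q p r) * v
        + (g p r q + g r p q) * cnj v = 0" by (simp only: mult_zero_right diff_self add_0_left mult_eq_0_iff mult_1_left) simp
    moreover note calculation } note c = this
  show "g p p q = 0" "g p q r + g q p r = 0" 
    "g p p p + g p q q + g q p q + g p r r + g r p r = 0"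
    using torus_linear[OF c(1)] torus_linear[OF c(2)] by (simp_all add: add.assoc)
qed

section \<open>Zeros of semidefinite forms\<close>

text \<open>
  The expression is the increment of a nonnegative quadratic form around a zero. Reality for all
  \<open>d\<close> forces \<open>Q = cnj P\<close>; a small step in the direction \<open>- P\<close> would then make the linear part
  dominate and the increment negative, unless \<open>P = 0\<close>.
\<close>

lemma nonneg_perturbation:
  assumes "\<And>d. cnj d * P + d * Q + cnj d * d * A \<in> \<real>\<^sub>\<ge>\<^sub>0"
  shows "P = 0"
proof -
  have r: "0 \<le> Re (cnj d * P + d * Q + cnj d * d * A)"
     "Im (cnj d * P + d * Q + cnj d * d * A) = 0" for d
    using assms[of d] by (auto simp: complex_nonneg_Reals_iff)
  have "Im P + Im Q + Im A = 0" "- Im P - Im Q + Im A = 0" "- Re P + Re Q + Im A = 0"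
    using r(2)[of 1] r(2)[of "-1"] r(2)[of "\<i>"] by simp_all
  then have Q: "Q = cnj P" and "Im A = 0" by (auto simp: complex_eq_iff)
  \<comment> \<open>The step length is chosen so small that the quadratic term cannot compensate the linear one.\<close>
  define e where "e = 1 / (1 + \<bar>Re A\<bar>)"
  have e: "e > 0" "e * Re A \<le> 1"  by (auto simp: e_def field_simps)
  define N where "N = (cmod P)\<^sup>2"
  have N: "complex_of_real N = P * cnj P"
    unfolding N_def by (rule complex_norm_square)
  have "cnj d * P + d * Q + cnj d * d * A = of_real (- 2 * e * N) + of_real (e * e * N) * A"
    if "d = - of_real e * P" for d
    unfolding that Q of_real_mult N by (simp add: algebra_simps)
  from r(1)[of "- of_real e * P", unfolded this[OF refl]]
  have "0 \<le> - 2 * e * N + e * e * N * Re A" by simp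
  also have "\<dots> = e * N * (e * Re A - 2)" by (simp add: algebra_simps)
  finally have "0 \<le> e * N * (e * Re A - 2)" .
  moreover have "e * N * (e * Re A - 2) \<le> e * N * (-1)"
    using e by (intro mult_left_mono) (auto simp: N_def)
  ultimately have "e * N \<le> 0" by simp
  then show ?thesis using e by (auto simp: mult_le_0_iff N_def)
qed

text \<open>
  A zero of a positive semidefinite form lies in its kernel: at a minimum, the derivative in each
  coordinate direction vanishes.
\<close>

lemma null_vector:
  fixes H :: "'n::finite \<Rightarrow> 'n \<Rightarrow> complex"
  assumes nonneg: "\<And>v. (\<Sum>k\<in>UNIV. \<Sum>l\<in>UNIV. cnj (v k) * v l * H k l) \<in> \<real>\<^sub>\<ge>\<^sub>0"
    and zero: "(\<Sum>k\<in>UNIV. \<Sum>l\<in>UNIV. cnj (w k) * w l * H k l) = 0"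
  shows "(\<Sum>l\<in>UNIV. w l * H k l) = 0"
proof (rule nonneg_perturbation)
  fix d :: complex
  define e where "e i = (if i = k then d else 0)" for i
  have e: "e i * y = (if i = k then d * y else 0)" "cnj (e i) * y = (if i = k then cnj d * y else 0)" for i y
    by (simp_all add: e_def)
  have "(\<Sum>i\<in>UNIV. \<Sum>l\<in>UNIV. cnj (w i + e i) * (w l + e l) * H i l) =
     (\<Sum>i\<in>UNIV. \<Sum>l\<in>UNIV. cnj (w i) * w l * H i l) + (\<Sum>i\<in>UNIV. cnj (e i) * (\<Sum>l\<in>UNIV. w l * H i l))
     + (\<Sum>i\<in>UNIV. cnj (w i) * (\<Sum>l\<in>UNIV. e l * H i l)) +  (\<Sum>i\<in>UNIV. cnj (e i) * (\<Sum>l\<in>UNIV. e l * H i l))"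
    by (simp add: algebra_simps sum.distrib sum_distrib_left)
  also have "\<dots> = cnj d * (\<Sum>l\<in>UNIV. w l * H k l) + d * (\<Sum>i\<in>UNIV. cnj (w i) * H i k) + cnj d * d * H k k"
    unfolding zero e by (simp add: sum_distrib_left mult_ac if_distrib cong: if_cong)
  finally show "cnj d * (\<Sum>l\<in>UNIV. w l * H k l) + d * (\<Sum>i\<in>UNIV. cnj (w i) * H i k) + cnj d * d * H k k \<in> \<real>\<^sub>\<ge>\<^sub>0"
    using nonneg[of "\<lambda>i. w i + e i"] by simp
qed

section \<open>The biquadratic form of a matrix map\<close>

definition matrix_unit :: "'n \<Rightarrow> 'n \<Rightarrow> complex^'n^'n" where
  "matrix_unit i j = (\<chi> a b. if a = i \<and> b = j then 1 else 0)"

definition coeff :: "(complex^'n^'n \<Rightarrow> complex^'m^'m) \<Rightarrow> 'n \<Rightarrow> 'n \<Rightarrow> 'm \<Rightarrow> 'm \<Rightarrow> complex" where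
  "coeff \<phi> i j k l = \<phi> (matrix_unit i j) $ k $ l"

text \<open>
  For linear \<open>\<phi>\<close> this is \<open>w\<^sup>* \<phi>(x x\<^sup>*) w\<close>. Expanded in coefficients, it is a semidefinite form in
  \<open>w\<close> for fixed \<open>x\<close> and also in \<open>x\<close> for fixed \<open>w\<close>, and both points of view are needed.
\<close>

definition biform :: "(complex^'n^'n \<Rightarrow> complex^'m^'m) \<Rightarrow> ('n \<Rightarrow> complex) \<Rightarrow> ('m \<Rightarrow> complex) \<Rightarrow> complex" where
  "biform \<phi> x w = (\<Sum>i\<in>UNIV. \<Sum>j\<in>UNIV. \<Sum>k\<in>UNIV. \<Sum>l\<in>UNIV.
     x i * cnj (x j) * cnj (w k) * w l * coeff \<phi> i j k l)"

lemma apply_eq_sum_coeff: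
  fixes \<phi> :: "complex^'n^'n \<Rightarrow> complex^'m^'m"
  assumes "Vector_Spaces.linear cscale_mat cscale_mat \<phi>"
  shows "\<phi> X $ k $ l = (\<Sum>i\<in>UNIV. \<Sum>j\<in>UNIV. X $ i $ j * coeff \<phi> i j k l)"
proof -
  interpret Vector_Spaces.linear cscale_mat cscale_mat \<phi> by fact
  have "X = (\<Sum>i\<in>UNIV. \<Sum>j\<in>UNIV. cscale_mat (X $ i $ j) (matrix_unit i j))"
  proof -
    have "(\<Sum>i\<in>UNIV. \<Sum>j\<in>UNIV. cscale_mat (X $ i $ j) (matrix_unit i j)) $ a $ b = X $ a $ b" for a b
    proof -
      have "(\<Sum>i\<in>UNIV. \<Sum>j\<in>UNIV. cscale_mat (X $ i $ j) (matrix_unit i j)) $ a $ b =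
        (\<Sum>i\<in>UNIV. \<Sum>j\<in>UNIV. if b = j then if a = i then X $ a $ b else 0 else 0)"
        unfolding cscale_mat_def matrix_unit_def sum_component by (intro sum.cong refl) auto
      then show ?thesis by simp
    qed
    then show ?thesis by (simp add: vec_eq_iff)
  qed
  then have "\<phi> X = (\<Sum>i\<in>UNIV. \<Sum>j\<in>UNIV. cscale_mat (X $ i $ j) (\<phi> (matrix_unit i j)))"
    by (metis (no_types, lifting) sum scale sum.cong)
  then show ?thesis
    by (simp add: cscale_mat_def coeff_def)
qed

lemma pos_semidef_outer: "pos_semidef (\<chi> i j. x i * cnj (x j) :: complex^'n^'n)"
proof -
  have "(\<Sum>i\<in>UNIV. cnj (v $ i) * ((\<chi> i j. x i * cnj (x j)) *v v) $ i) =
     (\<Sum>i\<in>UNIV. cnj (v $ i) * x i) * cnj (\<Sum>i\<in>UNIV. cnj (v $ i) * x i)" for v :: "complex^'n"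
    unfolding cnj_sum sum_product by (simp add: matrix_vector_mult_def sum_distrib_left mult_ac)
  moreover have "z * cnj z \<in> \<real>\<^sub>\<ge>\<^sub>0" for z
    by (auto simp: complex_nonneg_Reals_iff)
  ultimately show ?thesis
    unfolding pos_semidef_def hermitian_def by (auto simp del: cnj_sum)
qed

lemma biform_eq_outer:
  fixes \<phi> :: "complex^'n^'n \<Rightarrow> complex^'m^'m"
  assumes lin: "Vector_Spaces.linear cscale_mat cscale_mat \<phi>"
  shows "biform \<phi> x w = (\<Sum>k\<in>UNIV. \<Sum>l\<in>UNIV. cnj (w k) * w l * \<phi> (\<chi> i j. x i * cnj (x j)) $ k $ l)"
proof -
  have "(\<Sum>k\<in>UNIV. \<Sum>l\<in>UNIV. cnj (w k) * w l * \<phi> (\<chi> i j. x i * cnj (x j)) $ k $ l) =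
     (\<Sum>k\<in>UNIV. \<Sum>l\<in>UNIV. \<Sum>i\<in>UNIV. \<Sum>j\<in>UNIV. x i * cnj (x j) * cnj (w k) * w l * coeff \<phi> i j k l)"
    by (simp add: apply_eq_sum_coeff[OF lin] sum_distrib_left mult_ac)
  also have "\<dots> = (\<Sum>k\<in>UNIV. \<Sum>i\<in>UNIV. \<Sum>l\<in>UNIV. \<Sum>j\<in>UNIV. x i * cnj (x j) * cnj (w k) * w l * coeff \<phi> i j k l)"
    by (intro sum.cong refl sum.swap)
  also have "\<dots> = (\<Sum>k\<in>UNIV. \<Sum>i\<in>UNIV. \<Sum>j\<in>UNIV. \<Sum>l\<in>UNIV. x i * cnj (x j) * cnj (w k) * w l * coeff \<phi> i j k l)"
    by (intro sum.cong refl sum.swap)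
  also have "\<dots> = (\<Sum>i\<in>UNIV. \<Sum>k\<in>UNIV. \<Sum>j\<in>UNIV. \<Sum>l\<in>UNIV. x i * cnj (x j) * cnj (w k) * w l * coeff \<phi> i j k l)"
    by (rule sum.swap)
  also have "\<dots> = biform \<phi> x w"
    unfolding biform_def by (intro sum.cong refl sum.swap)
  finally show ?thesis ..
qed

lemma biform_nonneg:
  assumes "\<phi> \<in> positive_maps"
  shows "biform \<phi> x w \<in> \<real>\<^sub>\<ge>\<^sub>0"
proof -
  have lin: "Vector_Spaces.linear cscale_mat cscale_mat \<phi>"
    and psd: "pos_semidef (\<phi> (\<chi> i j. x i * cnj (x j)))"
    using assms pos_semidef_outer[of x] by (auto simp: positive_maps_def)
  from psd have "(\<Sum>k\<in>UNIV. cnj ((\<chi> k. w k) $ k) * (\<phi> (\<chi> i j. x i * cnj (x j)) *v (\<chi> k. w k)) $ k) \<in> \<real>\<^sub>\<ge>\<^sub>0"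
    unfolding pos_semidef_def by blast
  then show ?thesis
    by (simp add: biform_eq_outer[OF lin] matrix_vector_mult_def sum_distrib_left mult_ac)
qed

text \<open>
  A positive map sends \<open>x x\<^sup>*\<close> to Hermitian matrices. As these matrices span everything, the symmetry
  passes to the coefficients. The polarization is hidden in the use of \<open>null_vector\<close>: a form that is
  identically zero is semidefinite with every vector in its kernel.
\<close>

lemma coeff_cnj:
  assumes "\<phi> \<in> positive_maps"
  shows "coeff \<phi> j i l k = cnj (coeff \<phi> i j k l)"
proof -
  define H where "H b a = coeff \<phi> a b l k - cnj (coeff \<phi> b a k l)" for a b
  have lin: "Vector_Spaces.linear cscale_mat cscale_mat \<phi>"
    using assms by (auto simp: positive_maps_def)
  have H: "(\<Sum>b\<in>UNIV. \<Sum>a\<in>UNIV. cnj (x b) * x a * H b a) = 0" for x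
  proof -
    let ?O = "\<chi> i j. x i * cnj (x j)"
    have herm: "hermitian (\<phi> ?O)"
      using assms pos_semidef_outer[of x] by (auto simp: positive_maps_def pos_semidef_def)
    have lk: "\<phi> ?O $ l $ k = (\<Sum>b\<in>UNIV. \<Sum>a\<in>UNIV. cnj (x b) * x a * coeff \<phi> a b l k)"
      unfolding apply_eq_sum_coeff[OF lin] by (subst sum.swap) (simp add: mult_ac)
    have kl: "cnj (\<phi> ?O $ k $ l) = (\<Sum>b\<in>UNIV. \<Sum>a\<in>UNIV. cnj (x b) * x a * cnj (coeff \<phi> b a k l))"
      unfolding apply_eq_sum_coeff[OF lin] by (simp add: mult_ac)
    have "(\<Sum>b\<in>UNIV. \<Sum>a\<in>UNIV. cnj (x b) * x a * H b a) = \<phi> ?O $ l $ k - cnj (\<phi> ?O $ k $ l)"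
      unfolding lk kl H_def by (simp only: right_diff_distrib sum_subtractf)
    also have "\<dots> = 0"
      using herm unfolding hermitian_def by (metis diff_self)
    finally show ?thesis .
  qed
  have "(\<Sum>a\<in>UNIV. (if a = j then 1 else 0) * H i a) = 0"
  proof (rule null_vector)
    show "(\<Sum>b\<in>UNIV. \<Sum>a\<in>UNIV. cnj (v b) * v a * H b a) \<in> \<real>\<^sub>\<ge>\<^sub>0" for v
      unfolding H by simp
  qed (rule H)
  moreover have "(if a = j then 1 else 0) * H i a = (if a = j then H i j else 0)" for a
    by simp
  ultimately have "H i j = 0" by simp
  then show ?thesis by (simp add: H_def)
qed


section \<open>Positivity of the Choi map\<close>

text \<open>
  Evaluating the quadratic form on the span of two basis vectors gives the bound by the usual
  two-by-two minor argument.
\<close>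

lemma pos_semidef_entry_bound:
  fixes X :: "complex^'n^'n"
  assumes X: "pos_semidef X"
  shows "X $ i $ i = of_real (Re (X $ i $ i))" "0 \<le> Re (X $ i $ i)"
    and "cmod (X $ i $ j) \<le> sqrt (Re (X $ i $ i)) * sqrt (Re (X $ j $ j))"
proof -
  have quad: "cnj a * a * X$i$i + cnj b * b * X$j$j + cnj a * b * X$i$j + cnj b * a * X$j$i \<in> \<real>\<^sub>\<ge>\<^sub>0"
    (is "?q \<in> _") for i j a b
  proof -
    define v :: "complex^'n" where "v = (\<chi> k. (if k = i then a else 0) + (if k = j then b else 0))"
    have "(\<Sum>k\<in>UNIV. cnj (v $ k) * (X *v v) $ k) = ?q"
      by (simp add: v_def matrix_vector_mult_def algebra_simps sum.distrib if_distrib[of cnj]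
          if_distrib[of "\<lambda>x. _ * x"] if_distribR sum_distrib_left cong: if_cong)
    then show ?thesis using X unfolding pos_semidef_def by metis
  qed
  have diag: "X $ i $ i = of_real (Re (X $ i $ i)) \<and> 0 \<le> Re (X $ i $ i)" for i
    using quad[of 1 i 0 i] by (auto simp: complex_nonneg_Reals_iff complex_eq_iff)
  then show "X $ i $ i = of_real (Re (X $ i $ i))" "0 \<le> Re (X $ i $ i)" by auto
  define m a b where "m = X $ i $ j" and "a = Re (X $ i $ i)" and "b = Re (X $ j $ j)"
  have ji: "X $ j $ i = cnj m"
    using X unfolding m_def pos_semidef_def hermitian_def by blast
  have q: "0 \<le> (cmod z)\<^sup>2 * a + (cmod w)\<^sup>2 * b + 2 * Re (cnj z * w * m)" for z w
  proof -
    have "cnj z * z * X$i$i + cnj w * w * X$j$j + cnj z * w * X$i$j + cnj w * z * X$j$i =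
       of_real ((cmod z)\<^sup>2 * a + (cmod w)\<^sup>2 * b) + (cnj z * w * m + cnj (cnj z * w * m))"
      using diag[of i] diag[of j] unfolding ji a_def b_def m_def[symmetric] of_real_add of_real_mult complex_norm_square
      by (simp add: mult_ac)
    also have "\<dots> = of_real ((cmod z)\<^sup>2 * a + (cmod w)\<^sup>2 * b + 2 * Re (cnj z * w * m))"
      unfolding complex_add_cnj by simp
    finally show ?thesis
      using quad[of z i w j] by (simp only: nonneg_Reals_of_real_iff)
  qed
  have ab: "0 \<le> a" "0 \<le> b" using diag by (auto simp: a_def b_def)
  have "Re (cnj (- m) * of_real c * m) = - (c * (cmod m)\<^sup>2)" for c
    unfolding cmod_power2 by (simp add: power2_eq_square algebra_simps)
  from q[of "- m" "of_real _", unfolded this]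
  have "0 \<le> (cmod m)\<^sup>2 * a + c\<^sup>2 * b - 2 * (c * (cmod m)\<^sup>2)" for c :: real
    by simp
  note 1 = this[of a] this[of 1]
  have "Re (cnj (of_real c) * - cnj m * m) = - (c * (cmod m)\<^sup>2)" for c
    unfolding cmod_power2 by (simp add: power2_eq_square algebra_simps)
  from q[of "of_real _" "- cnj m", unfolded this]
  have "0 \<le> c\<^sup>2 * a + (cmod m)\<^sup>2 * b - 2 * (c * (cmod m)\<^sup>2)" for c :: real
    by simp
  note 2 = this[of b]
  have "(cmod m)\<^sup>2 \<le> a * b"
  proof (cases "a = 0 \<and> b = 0")
    case True then show ?thesis using 1 by simp
  next
    case False
    have "0 \<le> a * (a * b - (cmod m)\<^sup>2)" "0 \<le> b * (a * b - (cmod m)\<^sup>2)"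
      using 1(1) 2 by (simp_all add: power2_eq_square algebra_simps)
    then show ?thesis using False ab by (auto simp: zero_le_mult_iff)
  qed
  then have "cmod m \<le> sqrt (a * b)" by (rule real_le_rsqrt)
  then show "cmod (X $ i $ j) \<le> sqrt (Re (X $ i $ i)) * sqrt (Re (X $ j $ j))"
    by (simp add: real_sqrt_mult m_def a_def b_def)
qed

lemma linear_choi_map: "Vector_Spaces.linear cscale_mat cscale_mat choi_map"
  unfolding Vector_Spaces.linear_iff
  by (simp add: vector_space_cscale_mat vec_eq_iff forall_3 choi_map_entries cscale_mat_def algebra_simps)

text \<open>
  The entry bound for \<open>X\<close> makes a spectral decomposition superfluous: \<open>v\<^sup>* \<Phi>(X) v\<close> only decreases when
  each off-diagonal term is replaced by minus its largest possible modulus, and the result is the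
  real form at \<open>s i = sqrt (X i i)\<close> and \<open>t i = |v i|\<close>.
\<close>

lemma choi_map_positive: "choi_map \<in> positive_maps"
proof -
  have "pos_semidef (choi_map X)" if X: "pos_semidef X" for X
  proof -
    define s where "s i = sqrt (Re (X $ i $ i))" for i
    have diag: "X $ i $ i = of_real ((s i)\<^sup>2)" for i
      using pos_semidef_entry_bound(1,2)[OF X, of i] by (simp add: s_def)
    have herm: "X $ 2 $ 1 = cnj (X $ 1 $ 2)" "X $ 3 $ 1 = cnj (X $ 1 $ 3)" "X $ 3 $ 2 = cnj (X $ 2 $ 3)"
      using X unfolding pos_semidef_def hermitian_def by blast+
    have "hermitian (choi_map X)"
      unfolding hermitian_def forall_3 by (simp add: choi_map_entries diag herm)
    moreover have "(\<Sum>i\<in>UNIV. cnj (v $ i) * (choi_map X *v v) $ i) \<in> \<real>\<^sub>\<ge>\<^sub>0" for v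
    proof -
      define t where "t i = cmod (v $ i)" for i
      define m where "m i j = cnj (v $ i) * X $ i $ j * v $ j" for i j
      have m: "Re (m i j) \<le> s i * s j * t i * t j" for i j
      proof -
        have "Re (m i j) \<le> cmod (X $ i $ j) * (t i * t j)"
          using complex_Re_le_cmod[of "m i j"] by (simp add: m_def t_def norm_mult mult_ac)
        also have "\<dots> \<le> (s i * s j) * (t i * t j)"
          using pos_semidef_entry_bound(3)[OF X, of i j]
          by (intro mult_right_mono) (auto simp: s_def t_def)
        finally show ?thesis by (simp add: mult_ac)
      qed
      have tt: "of_real ((t i)\<^sup>2) = v $ i * cnj (v $ i)" for i
        unfolding t_def by (rule complex_norm_square)
      define S where "S = ((s 1)\<^sup>2 + (s 3)\<^sup>2) * (t 1)\<^sup>2 + ((s 2)\<^sup>2 + (s 1)\<^sup>2) * (t 2)\<^sup>2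
        + ((s 3)\<^sup>2 + (s 2)\<^sup>2) * (t 3)\<^sup>2"
      have "(\<Sum>i\<in>UNIV. cnj (v $ i) * (choi_map X *v v) $ i) =
        of_real S - ((m 1 2 + cnj (m 1 2)) + (m 1 3 + cnj (m 1 3)) + (m 2 3 + cnj (m 2 3)))"
        unfolding S_def of_real_add of_real_mult tt m_def sum_3 matrix_vector_mult_def
        by (simp add: sum_3 choi_map_entries diag herm algebra_simps)
      also have "\<dots> = of_real (S - 2 * (Re (m 1 2) + Re (m 1 3) + Re (m 2 3)))"
        unfolding complex_add_cnj by simp
      finally have eq: "(\<Sum>i\<in>UNIV. cnj (v $ i) * (choi_map X *v v) $ i) =
        of_real (S - 2 * (Re (m 1 2) + Re (m 1 3) + Re (m 2 3)))" .
      show ?thesis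
        unfolding eq nonneg_Reals_of_real_iff
        using real_choi_form_nonneg[of "s 1" "s 3" "t 1" "s 2" "t 2" "t 3"] m[of 1 2] m[of 1 3] m[of 2 3]
        unfolding S_def by argo
    qed
    ultimately show ?thesis by (simp add: pos_semidef_def)
  qed
  then show ?thesis
    by (simp add: positive_maps_def linear_choi_map)
qed

section \<open>Zeros of the Choi form\<close>

lemma biform_choi_map:
  "biform choi_map x w =
    (x 1 * cnj (x 1) + x 3 * cnj (x 3)) * (w 1 * cnj (w 1))
    + (x 2 * cnj (x 2) + x 1 * cnj (x 1)) * (w 2 * cnj (w 2))
    + (x 3 * cnj (x 3) + x 2 * cnj (x 2)) * (w 3 * cnj (w 3))
    - (x 1 * cnj (x 2) * cnj (w 1) * w 2 + x 2 * cnj (x 1) * cnj (w 2) * w 1)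
    - (x 1 * cnj (x 3) * cnj (w 1) * w 3 + x 3 * cnj (x 1) * cnj (w 3) * w 1)
    - (x 2 * cnj (x 3) * cnj (w 2) * w 3 + x 3 * cnj (x 2) * cnj (w 3) * w 2)"
  unfolding biform_eq_outer[OF linear_choi_map]
  unfolding sum_3 by (simp add: choi_map_entries)

text \<open>
  Computing the indices modulo 3 makes the cyclic symmetry of the Choi map visible: its \<open>k\<close>-th diagonal
  entry is \<open>X k k + X (k - 1) (k - 1)\<close>.
\<close>

lemma cyclic3_arith:
  "1 - 1 = (3::3)" "2 - 1 = (1::3)" "3 - 1 = (2::3)"
  "1 + 1 = (2::3)" "2 + 1 = (3::3)" "3 + 1 = (1::3)"
  by simp_all

lemma cyclic3:
  fixes i :: 3
  shows "i - 1 \<noteq> i" "i + 1 \<noteq> i" "i + 1 \<noteq> i - 1" "UNIV = {i, i + 1, i - 1}"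
proof -
  have "P i" if "P 1" "P 2" "P 3" for P
    using exhaust_3[of i] that by auto
  note cases = this
  show "i - 1 \<noteq> i" by (rule cases) (simp_all only: cyclic3_arith, simp_all)
  show "i + 1 \<noteq> i" by (rule cases) (simp_all only: cyclic3_arith, simp_all)
  show "i + 1 \<noteq> i - 1" by (rule cases) (simp_all only: cyclic3_arith, simp_all)
  show "UNIV = {i, i + 1, i - 1}" unfolding UNIV_3 
    by (rule cases) (simp_all only: cyclic3_arith, auto)
qed
lemma cyclic3_cases:
  fixes i k :: 3
  shows "k = i \<or> k = i + 1 \<or> k = i - 1"
proof -
  have "k \<in> UNIV" ..
  then show ?thesis unfolding cyclic3(4)[of i] by simp
qed

lemmas cyclic3_neq = cyclic3(1-3) cyclic3(1-3)[symmetric]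

lemma biform_choi_map_torus:
  assumes "\<And>i. cmod (x i) = 1"
  shows "biform choi_map x x = 0"
proof -
  define n where "n i = x i * cnj (x i)" for i
  have "n i = 1" for i unfolding n_def complex_norm_square[symmetric] by (simp add: assms)
  moreover have "biform choi_map x x = (n 1 + n 3) * n 1 + (n 2 + n 1) * n 2 + (n 3 + n 2) * n 3
     - 2 * n 1 * n 2 - 2 * n 1 * n 3 - 2 * n 2 * n 3"
    unfolding biform_choi_map n_def by (simp add: algebra_simps)
  ultimately show ?thesis by simp
qed

text \<open>
  This curve starts at the zero \<open>(e\<^sub>i, e\<^sub>i\<^sub>-\<^sub>1)\<close>, reached for \<open>t = 0\<close>, and along it the form vanishes to
  fourth order although its points are not zeros. A positive summand is therefore squeezed to fourth order
  as well.
\<close>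

lemma biform_choi_map_edge:
  fixes i :: 3
  assumes "x i = 1" "x (i - 1) = of_real t" "x (i + 1) = 0"
    and "w i = of_real t" "w (i - 1) = 1" "w (i + 1) = 0"
  shows "biform choi_map x w = of_real (t ^ 4)"
proof -
  note arith = cyclic3_arith
  consider (1) "i = 1" | (2) "i = 2" | (3) "i = 3" using exhaust_3[of i] by blast
  then show ?thesis
  proof cases
    case 1
    show ?thesis unfolding biform_choi_map assms[unfolded 1 arith] by (simp add: power4_eq_xxxx algebra_simps)
  next
    case 2
    show ?thesis unfolding biform_choi_map assms[unfolded 2 arith] by (simp add: power4_eq_xxxx algebra_simps)
  next
    case 3
    show ?thesis unfolding biform_choi_map assms[unfolded 3 arith] by (simp add: power4_eq_xxxx algebra_simps)
  qed
qed

lemma biform_choi_map_vertex: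
  "biform choi_map (\<lambda>k. if k = i then 1 else 0) (\<lambda>k. if k = i - 1 then 1 else 0) = 0"
proof -
  have "biform choi_map (\<lambda>k. if k = i then 1 else 0) (\<lambda>k. if k = i - 1 then 1 else 0) = of_real (0 ^ 4)"
    by (rule biform_choi_map_edge[of _ i]) (simp_all add: cyclic3_neq)
  then show ?thesis by simp
qed


section \<open>Summands of the Choi map\<close>

lemma biform_add: "biform (\<lambda>X. \<phi> X + \<psi> X) x w = biform \<phi> x w + biform \<psi> x w"
  by (simp add: biform_def coeff_def distrib_left sum.distrib)

text \<open>
  The coefficients one has to recover, up to a common factor, for a summand.
\<close>

lemma coeff_choi_map:
  "coeff choi_map i j k l =
    (if i = j then (if k = l \<and> k \<noteq> i - 1 then 1 else 0) else (if k = i \<and> l = j then - 1 else 0))"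
proof (cases "k = l")
  case True
  have "choi_map X $ k $ k = X $ k $ k + X $ (k - 1) $ (k - 1)" for X
    using exhaust_3[of k] by (elim disjE) (simp_all only: choi_map_entries cyclic3_arith)
  moreover have "k = i \<or> k = i + 1 \<or> k = i - 1"
    by (rule cyclic3_cases)
  ultimately show ?thesis
    using True by (auto simp: coeff_def matrix_unit_def cyclic3_neq)
next
  case False
  then show ?thesis
    by (auto simp: coeff_def matrix_unit_def choi_map_entries)
qed

lemma sum_indicator:
  fixes f :: "'a::finite \<Rightarrow> complex"
  shows "(\<Sum>a\<in>UNIV. (if a = i then 1 else 0) * f a) = f i"
    and "(\<Sum>a\<in>UNIV. cnj (if a = i then 1 else 0) * f a) = f i"
proof -
  have "(if a = i then 1 else 0) * f a = (if a = i then f i else 0)"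
    "cnj (if a = i then 1 else 0) * f a = (if a = i then f i else 0)" for a
    by simp_all
  then show "(\<Sum>a\<in>UNIV. (if a = i then 1 else 0) * f a) = f i"
    "(\<Sum>a\<in>UNIV. cnj (if a = i then 1 else 0) * f a) = f i"
    by simp_all
qed

lemma sum_sum_nest:
  fixes x y :: "'a \<Rightarrow> complex"
  shows "(\<Sum>i\<in>A. \<Sum>j\<in>B. x i * y j * f i j) = (\<Sum>i\<in>A. x i * (\<Sum>j\<in>B. y j * f i j))"
  by (simp only: sum_distrib_left mult.assoc)

lemma biform_nest:
  "biform \<phi> x w = (\<Sum>i\<in>UNIV. x i * (\<Sum>j\<in>UNIV. cnj (x j) *
     (\<Sum>k\<in>UNIV. cnj (w k) * (\<Sum>l\<in>UNIV. w l * coeff \<phi> i j k l))))"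
  unfolding biform_def by (simp only: sum_distrib_left mult.assoc)

text \<open>
  The setting is symmetric in \<open>\<phi>\<close> and \<open>\<psi>\<close>, so facts about the first summand hold for the second.
\<close>

locale choi_summand =
  fixes \<phi> \<psi> :: "complex^3^3 \<Rightarrow> complex^3^3"
  assumes pos: "\<phi> \<in> positive_maps" "\<psi> \<in> positive_maps"
    and sum_eq: "choi_map = (\<lambda>X. \<phi> X + \<psi> X)"
begin

abbreviation c where "c \<equiv> coeff \<phi>"

lemma biform_split: "biform choi_map x w = biform \<phi> x w + biform \<psi> x w"
  unfolding sum_eq by (rule biform_add)

lemma biform_zero:
  assumes "biform choi_map x w = 0"
  shows "biform \<phi> x w = 0"
  using assms biform_nonneg[OF pos(1), of x w] biform_nonneg[OF pos(2), of x w]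
  unfolding biform_split by (auto simp: complex_nonneg_Reals_iff complex_eq_iff)

text \<open>
  At a zero of the Choi form the form of \<open>\<phi>\<close> vanishes too, so \<open>w\<close> is in the kernel of \<open>\<phi>(x x\<^sup>*)\<close>.
\<close>

lemma output_null:
  assumes "biform choi_map x w = 0"
  shows "(\<Sum>l\<in>UNIV. w l * (\<Sum>i\<in>UNIV. \<Sum>j\<in>UNIV. x i * cnj (x j) * c i j k l)) = 0"
proof -
  have eq: "(\<Sum>k\<in>UNIV. \<Sum>l\<in>UNIV. cnj (v k) * v l * (\<Sum>i\<in>UNIV. \<Sum>j\<in>UNIV. x i * cnj (x j) * c i j k l))
    = biform \<phi> x v" for v
  proof -
    have lin: "Vector_Spaces.linear cscale_mat cscale_mat \<phi>"
      using pos(1) by (simp add: positive_maps_def)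
    show ?thesis unfolding biform_eq_outer[OF lin] apply_eq_sum_coeff[OF lin] by simp
  qed
  show ?thesis
    by (rule null_vector[where H = "\<lambda>k l. \<Sum>i\<in>UNIV. \<Sum>j\<in>UNIV. x i * cnj (x j) * c i j k l"])
      (simp_all only: eq biform_nonneg[OF pos(1)] biform_zero[OF assms])
qed

text \<open>
  The same in the other variable: for fixed \<open>w\<close> the form is semidefinite in \<open>x\<close>, and \<open>x\<close> is in its kernel.
\<close>

lemma input_null:
  assumes "biform choi_map x w = 0"
  shows "(\<Sum>i\<in>UNIV. x i * (\<Sum>k\<in>UNIV. \<Sum>l\<in>UNIV. cnj (w k) * w l * c i j k l)) = 0"
proof -
  have eq: "(\<Sum>j\<in>UNIV. \<Sum>i\<in>UNIV. cnj (v j) * v i * (\<Sum>k\<in>UNIV. \<Sum>l\<in>UNIV. cnj (w k) * w l * c i j k l))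
    = biform \<phi> v w" for v
    unfolding biform_def by (subst sum.swap) (simp add: sum_distrib_left mult_ac)
  show ?thesis
    by (rule null_vector[where H = "\<lambda>j i. \<Sum>k\<in>UNIV. \<Sum>l\<in>UNIV. cnj (w k) * w l * c i j k l"])
      (simp_all only: eq biform_nonneg[OF pos(1)] biform_zero[OF assms])
qed

lemma output_torus:
  assumes "\<And>i. cmod (x i) = 1"
  shows "(\<Sum>i\<in>UNIV. \<Sum>l\<in>UNIV. \<Sum>j\<in>UNIV. x i * x l * cnj (x j) * c i j k l) = 0"
  using output_null[OF biform_choi_map_torus, of x k] assms
  by (subst sum.swap) (simp add: sum_distrib_left mult_ac)

lemma input_torus:
  assumes "\<And>i. cmod (x i) = 1"
  shows "(\<Sum>i\<in>UNIV. \<Sum>l\<in>UNIV. \<Sum>k\<in>UNIV. x i * x l * cnj (x k) * c i j k l) = 0"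
proof -
  have "(\<Sum>i\<in>UNIV. \<Sum>l\<in>UNIV. \<Sum>k\<in>UNIV. x i * x l * cnj (x k) * c i j k l) =
    (\<Sum>i\<in>UNIV. \<Sum>k\<in>UNIV. \<Sum>l\<in>UNIV. x i * x l * cnj (x k) * c i j k l)"
    by (intro sum.cong refl sum.swap)
  then show ?thesis
    using input_null[OF biform_choi_map_torus, of x j] assms
    by (simp add: sum_distrib_left mult_ac)
qed

lemmas herm = coeff_cnj[OF pos(1)]

text \<open>
  The coefficient of the monomial \<open>x i ^ 2 / x j\<close> (or \<open>x i ^ 2 / x k\<close>) has only one term, since the two
  numerator indices agree.
\<close>

lemma coeff_ends_eq:
  assumes "i \<noteq> j \<or> i \<noteq> k"
  shows "c i j k i = 0"
proof -
  have ex: "\<exists>r. i \<noteq> r \<and> y \<noteq> r" for y :: 3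
    using cyclic3[of i] by metis
  show ?thesis
  proof (cases "i = j")
    case False
    with ex[of j] obtain r where "i \<noteq> r" "j \<noteq> r" by blast
    then show ?thesis
      using False by (intro torus_cubic(1)[where g = "\<lambda>i l j. c i j k l" and r = r] output_torus)
  next
    case True
    with assms have "i \<noteq> k" by simp
    with ex[of k] obtain r where "i \<noteq> r" "k \<noteq> r" by blast
    then show ?thesis
      using \<open>i \<noteq> k\<close> by (intro torus_cubic(1)[where g = "\<lambda>i l k. c i j k l" and r = r] input_torus)
  qed
qed

lemma coeff_mid_eq:
  assumes "i \<noteq> j \<or> l \<noteq> j"
  shows "c i j j l = 0"
  using coeff_ends_eq[of j i l] herm[of i j j l] assms by auto

lemma coeff_exchange_output:
  assumes "i \<noteq> l" "i \<noteq> j" "l \<noteq> j"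
  shows "c i j k l + c l j k i = 0"
  using assms by (intro torus_cubic(2)[where g = "\<lambda>i l j. c i j k l"] output_torus)

lemma coeff_exchange_input:
  assumes "i \<noteq> l" "i \<noteq> k" "l \<noteq> k"
  shows "c i j k l + c l j k i = 0"
  using assms by (intro torus_cubic(2)[where g = "\<lambda>i l k. c i j k l"] input_torus)

text \<open>
  From the zero \<open>(e\<^sub>i, e\<^sub>i\<^sub>-\<^sub>1)\<close>: the vector \<open>e\<^sub>i\<^sub>-\<^sub>1\<close> is in the kernel of the image of the \<open>i\<close>-th
  diagonal matrix unit.
\<close>

lemma coeff_vertex: "c i i k (i - 1) = 0" "c i i (i - 1) k = 0"
proof -
  have "c i i k (i - 1) = 0" for k
  proof -
    have "(\<Sum>l\<in>UNIV. (if l = i - 1 then 1 else 0) * (\<Sum>a\<in>UNIV. \<Sum>b\<in>UNIV.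
        (if a = i then 1 else 0) * cnj (if b = i then 1 else 0) * c a b k l)) = 0"
      by (rule output_null[OF biform_choi_map_vertex])
    then show ?thesis by (simp only: sum_indicator sum_sum_nest)
  qed
  from this this[of k] herm[of i i "i - 1" k] show "c i i k (i - 1) = 0" "c i i (i - 1) k = 0"
    by auto
qed

text \<open>
  Two distinct indices other than \<open>i\<close> must include \<open>i - 1\<close>, where the vertex zero applies; otherwise
  the torus zeros apply.
\<close>

lemma coeff_diag_offdiag:
  assumes "k \<noteq> l"
  shows "c i i k l = 0"
proof (cases "k = i \<or> l = i")
  case True
  then show ?thesis using coeff_ends_eq[of i i k] coeff_mid_eq[of i i l] assms by auto
next
  case False
  then have "k = i - 1 \<or> l = i - 1" using assms cyclic3_cases[of k i] cyclic3_cases[of l i] False by blast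
  then show ?thesis using coeff_vertex by auto
qed

text \<open>
  The image of an off-diagonal matrix unit is a multiple of that matrix unit. With \<open>m\<close> the third
  index, its entries in column \<open>i\<close> or row \<open>j\<close> vanish by themselves, and each of the entries
  \<open>(m, j)\<close>, \<open>(i, m)\<close> and \<open>(m, m)\<close> is exchanged for one that is already known to vanish.
\<close>

lemma coeff_offdiag:
  assumes ij: "i \<noteq> j" and kl: "k \<noteq> i \<or> l \<noteq> j"
  shows "c i j k l = 0"
proof -
  have mj: "c i j m j = 0" if "i \<noteq> j" "m \<noteq> i" "m \<noteq> j" for i j m
    using coeff_exchange_input[of i j m j] coeff_diag_offdiag[of m i j] that by auto
  have im: "c i j i m = 0" if "i \<noteq> j" "m \<noteq> i" "m \<noteq> j" for i j m
    using mj[of j i m] herm[of i j i m] that by auto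
  have mm: "c i j m m = 0" if "i \<noteq> j" "m \<noteq> i" "m \<noteq> j" for i j m
    using coeff_exchange_output[of i m j m] im[of m j i] that by auto
  obtain m where m: "m \<noteq> i" "m \<noteq> j" and ijm: "\<And>y. y = i \<or> y = j \<or> y = m"
    using cyclic3_cases[of _ i] cyclic3_neq[of i] ij by metis
  consider "l = i" | "k = j" | "k = m" "l = m" | "k = m" "l = j" | "k = i" "l = m"
    using kl ijm[of k] ijm[of l] by blast
  then show ?thesis
    by cases (use coeff_ends_eq coeff_mid_eq mj im mm ij m in auto)
qed

text \<open>
  The coefficient of the monomial \<open>x p\<close> in the torus identity, with \<open>p\<close> also as the output row.
\<close>

lemma coeff_balance: "c p p p p + c (p - 1) (p - 1) p p + c p (p + 1) p (p + 1) + c p (p - 1) p (p - 1) = 0"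
proof -
  have "c p p p p + c p (p + 1) p (p + 1) + c (p + 1) (p + 1) p p
      + c p (p - 1) p (p - 1) + c (p - 1) (p - 1) p p = 0"
    using cyclic3_neq[of p]
    by (intro torus_cubic(3)[where g = "\<lambda>i l j. c i j p l"] output_torus)
  moreover have "c (p + 1) (p + 1) p p = 0"
    using coeff_vertex(1)[of "p + 1" p] by simp
  ultimately show ?thesis by (simp add: add_ac)
qed

lemma coeff_diag_nonneg: "c i i k k \<in> \<real>\<^sub>\<ge>\<^sub>0"
proof -
  have "biform \<phi> (\<lambda>a. if a = i then 1 else 0) (\<lambda>a. if a = k then 1 else 0) = c i i k k"
    unfolding biform_nest by (simp only: sum_indicator)
  then show ?thesis
    using biform_nonneg[OF pos(1)] by metis
qed

lemma biform_edge:
  fixes i :: 3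
  assumes "x (i + 1) = 0" "w (i + 1) = 0"
  shows "biform \<phi> x w =
    x i * cnj (x i) * (w i * cnj (w i)) * c i i i i
    + x (i - 1) * cnj (x (i - 1)) * (w i * cnj (w i)) * c (i - 1) (i - 1) i i
    + x (i - 1) * cnj (x (i - 1)) * (w (i - 1) * cnj (w (i - 1))) * c (i - 1) (i - 1) (i - 1) (i - 1)
    + x i * cnj (x (i - 1)) * cnj (w i) * w (i - 1) * c i (i - 1) i (i - 1)
    + x (i - 1) * cnj (x i) * cnj (w (i - 1)) * w i * c (i - 1) i (i - 1) i"
proof -
  have S: "(\<Sum>k\<in>UNIV. h k) = h i + h (i + 1) + h (i - 1)" for h :: "3 \<Rightarrow> complex"
    unfolding cyclic3(4)[of i] using cyclic3_neq[of i] by (simp add: add.assoc)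
  show ?thesis
    unfolding biform_def S assms
    by (simp add: coeff_offdiag coeff_diag_offdiag coeff_vertex cyclic3_neq)
qed

text \<open>
  The kernel conditions do not relate the entries \<open>c i i i i\<close> to each other; the curve of
  \<open>biform_choi_map_edge\<close> does. Let \<open>P z\<close> be the quadratic part of the form of \<open>\<phi>\<close> when the input
  moves by \<open>t * z\<close> and the output by \<open>t\<close> from the zero \<open>(e\<^sub>i, e\<^sub>i\<^sub>-\<^sub>1)\<close>. It is nonnegative for all complex \<open>z\<close>, and
  \<open>P 1 = 0\<close> because along the curve the form of \<open>\<phi>\<close> is at most \<open>t ^ 4\<close>. So \<open>P\<close> has a minimum at
  \<open>1\<close>, and the derivative there gives the off-diagonal coefficient, phase included.
\<close>

lemma coeff_edge: "c i (i - 1) i (i - 1) = - c i i i i" "c (i - 1) (i - 1) (i - 1) (i - 1) = c i i i i"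
proof -
  define a a' b L where "a = c i i i i" and "a' = c (i - 1) (i - 1) (i - 1) (i - 1)"
    and "b = c (i - 1) (i - 1) i i" and "L = c i (i - 1) i (i - 1)"
  have L': "c (i - 1) i (i - 1) i = cnj L" unfolding L_def by (rule herm)
  define P where "P z = a + a' * (z * cnj z) + L * cnj z + cnj L * z" for z
  have form: "biform \<phi> (\<lambda>k. if k = i then 1 else if k = i - 1 then of_real t * z else 0)
      (\<lambda>k. if k = i then of_real t else if k = i - 1 then 1 else 0) =
      of_real (t\<^sup>2) * (P z + of_real (t\<^sup>2) * (b * (z * cnj z)))" for t z
    by (subst biform_edge[of _ i])
      (simp_all add: cyclic3_neq L' a_def[symmetric] a'_def[symmetric] b_def[symmetric] L_def[symmetric] P_def
        power2_eq_square algebra_simps)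
  have im: "Im (P z) = 0" for z
  proof -
    have "Im a = 0" "Im a' = 0"
      using coeff_diag_nonneg[of i i] coeff_diag_nonneg[of "i - 1" "i - 1"]
      unfolding a_def a'_def complex_nonneg_Reals_iff by blast+
    then show ?thesis by (simp add: P_def)
  qed
  have Re_of_real_mult: "Re (of_real s * y) = s * Re y" for s y
    by simp
  have lower: "0 \<le> Re (P z) + t\<^sup>2 * Re (b * (z * cnj z))" if "t \<noteq> 0" for t z
  proof -
    have "0 \<le> Re (of_real (t\<^sup>2) * (P z + of_real (t\<^sup>2) * (b * (z * cnj z))))"
      using biform_nonneg[OF pos(1), of "\<lambda>k. if k = i then 1 else if k = i - 1 then of_real t * z else 0"
          "\<lambda>k. if k = i then of_real t else if k = i - 1 then 1 else 0"]
      unfolding form complex_nonneg_Reals_iff by (rule conjunct1)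
    then have "t\<^sup>2 * 0 \<le> t\<^sup>2 * (Re (P z) + t\<^sup>2 * Re (b * (z * cnj z)))"
      unfolding Re_of_real_mult plus_complex.sel by simp
    then show ?thesis
      by (rule mult_left_le_imp_le) (use that in simp)
  qed
  have upper: "Re (P 1) + t\<^sup>2 * Re b \<le> t\<^sup>2" if "t \<noteq> 0" for t
  proof -
    let ?x = "\<lambda>k. if k = i then 1 else if k = i - 1 then of_real t * 1 else 0"
    let ?w = "\<lambda>k. if k = i then of_real t else if k = i - 1 then 1 else 0"
    have "of_real (t ^ 4) = biform choi_map ?x ?w"
      by (rule biform_choi_map_edge[symmetric, of _ i]) (simp_all add: cyclic3_neq)
    also have "\<dots> = of_real (t\<^sup>2) * (P 1 + of_real (t\<^sup>2) * b) + biform \<psi> ?x ?w"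
      unfolding biform_split form by (simp only: complex_cnj_one mult_1_right)
    finally have "Re (of_real (t ^ 4)) = Re (of_real (t\<^sup>2) * (P 1 + of_real (t\<^sup>2) * b) + biform \<psi> ?x ?w)"
      by (rule arg_cong)
    then have "t ^ 4 = t\<^sup>2 * (Re (P 1) + t\<^sup>2 * Re b) + Re (biform \<psi> ?x ?w)"
      unfolding plus_complex.sel Re_of_real_mult Re_complex_of_real .
    moreover have "0 \<le> Re (biform \<psi> ?x ?w)"
      using biform_nonneg[OF pos(2)] by (simp add: complex_nonneg_Reals_iff)
    ultimately have "t\<^sup>2 * (Re (P 1) + t\<^sup>2 * Re b) \<le> t ^ 4"
      by linarith
    also have "t ^ 4 = t\<^sup>2 * t\<^sup>2"
      by (simp add: power2_eq_square power4_eq_xxxx)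
    finally show ?thesis
      by (rule mult_left_le_imp_le) (use that in simp)
  qed
  \<comment> \<open>Only the terms of order two in t matter: the remainder disappears in the limit.\<close>
  have small: "0 \<le> A" if "\<And>t. t \<noteq> 0 \<Longrightarrow> 0 \<le> A + t\<^sup>2 * B" for A B :: real
  proof -
    have "((\<lambda>t. A + t\<^sup>2 * B) \<longlongrightarrow> A + 0\<^sup>2 * B) (at 0)"
      by (intro tendsto_intros)
    then have "0 \<le> A + 0\<^sup>2 * B"
      by (rule tendsto_lowerbound) (auto simp: eventually_at_filter that)
    then show ?thesis by simp
  qed
  have nonneg: "0 \<le> Re (P z)" for z
    by (rule small) (rule lower)
  have "0 \<le> - Re (P 1)"
  proof (rule small)
    show "0 \<le> - Re (P 1) + t\<^sup>2 * (1 - Re b)" if "t \<noteq> 0" for t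
      using upper[OF that] by (simp add: algebra_simps)
  qed
  with nonneg[of 1] have "Re (P 1) = 0" by linarith
  then have P1: "P 1 = 0" using im by (simp add: complex_eq_iff)
  have "a' + L = 0"
  proof (rule nonneg_perturbation)
    fix d
    have "P (1 + d) = P 1 + (cnj d * (a' + L) + d * (a' + cnj L) + cnj d * d * a')"
      by (simp add: P_def algebra_simps)
    then show "cnj d * (a' + L) + d * (a' + cnj L) + cnj d * d * a' \<in> \<real>\<^sub>\<ge>\<^sub>0"
      using P1 nonneg[of "1 + d"] im[of "1 + d"] by (simp add: complex_nonneg_Reals_iff)
  qed
  then have L: "L = - a'" by (simp add: eq_neg_iff_add_eq_0 add.commute)
  have "cnj a' = a'"
    using coeff_diag_nonneg[of "i - 1" "i - 1"] by (simp add: a'_def complex_nonneg_Reals_iff complex_eq_iff)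
  then have "a = a'" using P1 by (simp add: P_def L)
  with L show "c i (i - 1) i (i - 1) = - c i i i i" "c (i - 1) (i - 1) (i - 1) (i - 1) = c i i i i"
    by (simp_all add: a_def a'_def L_def)
qed

text \<open>
  All \<open>c i i i i\<close> agree by \<open>coeff_edge\<close>, which also gives the off-diagonal coefficients; the remaining
  diagonal entries follow from \<open>coeff_balance\<close>.
\<close>

lemma proportional: "\<exists>r\<ge>0. \<phi> = (\<lambda>X. r *\<^sub>R choi_map X)"
proof -
  define r where "r = Re (c 1 1 1 1)"
  have r: "0 \<le> r" "c 1 1 1 1 = of_real r"
    using coeff_diag_nonneg[of 1 1] by (auto simp: r_def complex_nonneg_Reals_iff complex_eq_iff)
  have "c 3 3 3 3 = c 1 1 1 1" "c 2 2 2 2 = c 3 3 3 3"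
    using coeff_edge(2)[of 1] coeff_edge(2)[of 3] unfolding cyclic3_arith by simp_all
  then have diag: "c i i i i = of_real r" for i
    using exhaust_3[of i] r by auto
  have down: "c i (i - 1) i (i - 1) = - of_real r" for i
    using coeff_edge(1)[of i] diag by simp
  have up: "c i (i + 1) i (i + 1) = - of_real r" for i
    using down[of "i + 1"] herm[of i "i + 1" i "i + 1"] by (simp add: cyclic3_neq)
  have nxt: "c (i - 1) (i - 1) i i = of_real r" for i
    using coeff_balance[of i] by (simp add: diag up down)
  have "c i j k l = of_real r * coeff choi_map i j k l" for i j k l
  proof (cases "i = j")
    case True
    have "k = i \<or> k = i + 1 \<or> k = i - 1"
      by (rule cyclic3_cases)
    then show ?thesis
      using True nxt[of "i + 1"] coeff_vertex[of i] diag[of i] coeff_diag_offdiag[of k l i]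
      by (cases "k = l") (auto simp: coeff_choi_map cyclic3_neq)
  next
    case False
    have "j = i + 1 \<or> j = i - 1"
      using cyclic3_cases[of j i] False by blast
    then show ?thesis
      using False up[of i] down[of i] coeff_offdiag[OF False, of k l]
      by (cases "k = i \<and> l = j") (auto simp: coeff_choi_map)
  qed
  note coeff_eq = this
  have lin: "Vector_Spaces.linear cscale_mat cscale_mat \<phi>"
    using pos(1) by (simp add: positive_maps_def)
  have "\<phi> X $ k $ l = of_real r * choi_map X $ k $ l" for X k l
    unfolding apply_eq_sum_coeff[OF lin] apply_eq_sum_coeff[OF linear_choi_map] coeff_eq
    by (simp add: sum_distrib_left mult_ac)
  then have "\<phi> X $ k $ l = (r *\<^sub>R choi_map X) $ k $ l" for X k l
    by (simp add: scaleR_conv_of_real[of r "choi_map X $ k $ l"])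
  then have "\<phi> = (\<lambda>X. r *\<^sub>R choi_map X)" by (simp add: fun_eq_iff vec_eq_iff)
  with r show ?thesis by blast
qed

end

section \<open>Extremality\<close>

theorem theorem2p4:
  shows "generates_extreme_ray (positive_maps :: (complex^3^3 \<Rightarrow> complex^3^3) set) choi_map"
  unfolding generates_extreme_ray_def
proof (intro conjI ballI impI)
  show "choi_map \<in> positive_maps" by (rule choi_map_positive)
  have "choi_map (matrix_unit 1 1) $ 1 $ 1 = 1"
    by (simp add: choi_map_entries matrix_unit_def)
  then show "choi_map \<noteq> (\<lambda>X. 0)" by (metis zero_index zero_neq_one)
  fix \<phi>1 \<phi>2 :: "complex^3^3 \<Rightarrow> complex^3^3"
  assume pos: "\<phi>1 \<in> positive_maps" "\<phi>2 \<in> positive_maps" and eq: "choi_map = (\<lambda>X. \<phi>1 X + \<phi>2 X)"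
  interpret a: choi_summand \<phi>1 \<phi>2 using pos eq by unfold_locales
  interpret b: choi_summand \<phi>2 \<phi>1 using pos eq by unfold_locales (simp_all add: add.commute)
  show "\<exists>c\<ge>0. \<phi>1 = (\<lambda>X. c *\<^sub>R choi_map X)" by (rule a.proportional)
  show "\<exists>c\<ge>0. \<phi>2 = (\<lambda>X. c *\<^sub>R choi_map X)" by (rule b.proportional)
qed
end
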